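(* Let $H$ be a separable real Hilbert space, $U\subset H$ a closed subspace, and $Q\in L(H)$ a nonnegative self-adjoint nuclear operator such that $U$ and $U^\perp$ are $Q$-invariant. Consider the statistical model $(\mathbb{P}_\vartheta)_{\vartheta\in\Theta}$ on $H$ with $\Theta=U\times(0,\infty)$ and $\mathbb{P}_\vartheta=\mathrm{N}(\zeta,\sigma^2Q)$ for $\vartheta=(\zeta,\sigma)$, with observation $Y$, and let $\widehat{\zeta}(Y):=\Pi_UY$. Let $b\in H$ be arbitrary, and let $c\in H$ be such that $\langle c,Y\rangle$ is an unbiased estimator for $\langle b,\zeta\rangle$. Then: (1) $R_\vartheta[\langle b,\widehat{\zeta}(Y)\rangle]\le R_\vartheta[\langle c,Y\rangle]$ for all $\vartheta\in\Theta$. (2) If $R_\vartheta[\langle b,\widehat{\zeta}(Y)\rangle]=R_\vartheta[\langle c,Y\rangle]$ for all $\vartheta\in\Theta$, then $\langle c,Y\rangle=\langle b,\widehat{\zeta}(Y)\rangle$ $\mathbb{P}_\vartheta$-almost surely for each $\vartheta\in\Theta$.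
   Context: A subspace $V$ is $Q$-invariant if $Q(V)\subset V$. $\Pi_V$ is the orthogonal projection onto a closed subspace $V$. $\mathrm{N}(\zeta,\sigma^2Q)$ is the Gaussian measure on $H$ with mean $\zeta$ and covariance operator $\sigma^2Q$, i.e. if $Y$ has this law then $\langle b,Y\rangle\sim\mathrm{N}(\langle b,\zeta\rangle,\sigma^2\langle Qb,b\rangle)$ (possibly degenerate) for all $b\in H$. $Y$ is the observation (the identity map on $H$), so $Y\sim\mathrm{N}(\zeta,\sigma^2Q)$ under $\mathbb{P}_\vartheta$, and $\mathbb{E}_\vartheta$ is expectation under $\mathbb{P}_\vartheta$. A real-valued estimator $X$ is unbiased for $\langle b,\zeta\rangle$ if $\mathbb{E}_\vartheta[X]=\langle b,\zeta\rangle$ for all $\vartheta=(\zeta,\sigma)\in\Theta$. The risk of a real-valued estimator $X$ of $\langle b,\zeta\rangle$ is $R_\vartheta[X]:=\mathbb{E}_\vartheta[|X-\langle b,\zeta\rangle|^2]$. *)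

theory Defs
  imports "HOL-Probability.Probability"
begin

text \<open>A real Hilbert space is a type of sort \<open>{real_inner, complete_space}\<close>; it is separable
  iff it is moreover second countable.  Bounded operators are elements of the type
  \<open>'a \<Rightarrow>\<^sub>L 'a\<close>.\<close>

definition self_adjoint :: "('a::real_inner \<Rightarrow>\<^sub>L 'a) \<Rightarrow> bool" where
  "self_adjoint Q \<longleftrightarrow> (\<forall>x y. inner (Q x) y = inner x (Q y))"

definition nonneg_operator :: "('a::real_inner \<Rightarrow>\<^sub>L 'a) \<Rightarrow> bool" where
  "nonneg_operator Q \<longleftrightarrow> (\<forall>x. 0 \<le> inner (Q x) x)"

definition nuclear :: "('a::real_inner \<Rightarrow>\<^sub>L 'a) \<Rightarrow> bool" where
  "nuclear Q \<longleftrightarrow> (\<exists>u v :: nat \<Rightarrow> 'a.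
     summable (\<lambda>n. norm (u n) * norm (v n)) \<and>
     (\<forall>x. (\<lambda>n. inner (u n) x *\<^sub>R v n) sums Q x))"

definition invariant_subspace :: "('a::real_inner \<Rightarrow>\<^sub>L 'a) \<Rightarrow> 'a set \<Rightarrow> bool" where
  "invariant_subspace Q V \<longleftrightarrow> subspace V \<and> Q ` V \<subseteq> V"

text \<open>The description below determines a unique point whenever \<open>V\<close> is a closed subspace of a
  Hilbert space.\<close>

definition orth_proj :: "'a::real_inner set \<Rightarrow> 'a \<Rightarrow> 'a" where
  "orth_proj V x = (THE p. p \<in> V \<and> x - p \<in> V\<^sup>\<bottom>)"

text \<open>The normal law on the line with mean \<open>m\<close> and variance \<open>v \<ge> 0\<close>; it is a point mass
  if \<open>v = 0\<close>.  The library density takes the standard deviation as its parameter.\<close>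

definition normal_law :: "real \<Rightarrow> real \<Rightarrow> real measure" where
  "normal_law m v =
     (if v = 0 then return borel m
      else density lborel (\<lambda>x. ennreal (normal_density m (sqrt v) x)))"

text \<open>\<open>gaussian_measure M m C\<close> says that the Borel measure \<open>M\<close> is the law
  \<open>N(m, C)\<close>, which is determined by its one-dimensional marginals.\<close>

definition gaussian_measure ::
    "'a::real_inner measure \<Rightarrow> 'a \<Rightarrow> ('a \<Rightarrow>\<^sub>L 'a) \<Rightarrow> bool" where
  "gaussian_measure M m C \<longleftrightarrow> sets M = sets borel \<and> prob_space M \<and>
     (\<forall>b. distr M borel (\<lambda>y. inner b y) = normal_law (inner b m) (inner (C b) b))"

text \<open>Below, a parameter is a pair \<open>(\<zeta>, \<sigma>)\<close>, and a real-valued estimator is a function of the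
  observation, that is, a function on the sample space \<open>'a\<close>.\<close>

definition param_space :: "'a set \<Rightarrow> ('a \<times> real) set" where
  "param_space U = U \<times> {0<..}"

definition gaussian_model ::
    "('a::real_inner \<times> real \<Rightarrow> 'a measure) \<Rightarrow> 'a set \<Rightarrow> ('a \<Rightarrow>\<^sub>L 'a) \<Rightarrow> bool" where
  "gaussian_model P U Q \<longleftrightarrow>
     (\<forall>(\<zeta>, \<sigma>) \<in> param_space U. gaussian_measure (P (\<zeta>, \<sigma>)) \<zeta> (\<sigma>\<^sup>2 *\<^sub>R Q))"

text \<open>Integrability is stated because the Bochner integral of a non-integrable function is 0.\<close>

definition unbiased_estimator ::
    "('a::real_inner \<times> real \<Rightarrow> 'a measure) \<Rightarrow> 'a set \<Rightarrow> 'a \<Rightarrow> ('a \<Rightarrow> real) \<Rightarrow> bool" where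
  "unbiased_estimator P U b X \<longleftrightarrow>
     (\<forall>(\<zeta>, \<sigma>) \<in> param_space U. integrable (P (\<zeta>, \<sigma>)) X \<and>
        (\<integral>y. X y \<partial>P (\<zeta>, \<sigma>)) = inner b \<zeta>)"

text \<open>The quadratic risk of \<open>X\<close> as an estimator of \<open>\<langle>b, \<zeta>\<rangle>\<close>, with values in \<open>[0, \<infinity>]\<close>.\<close>

definition risk ::
    "('a::real_inner \<times> real \<Rightarrow> 'a measure) \<Rightarrow> 'a \<Rightarrow> 'a \<times> real \<Rightarrow> ('a \<Rightarrow> real) \<Rightarrow> ennreal" where
  "risk P b \<theta> X = (\<integral>\<^sup>+y. ennreal (\<bar>X y - inner b (fst \<theta>)\<bar>\<^sup>2) \<partial>P \<theta>)"

end

theory Submission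
  imports Defs
begin

text \<open>
  This is the Gauss--Markov theorem in a Hilbert space; as the noise splits into independent
  parts along \<open>U\<close> and \<open>U\<^sup>\<bottom>\<close>, its proof is Pythagoras' theorem for the form \<open>\<langle>Qx, x\<rangle>\<close>.

  Let \<open>p\<close> be the projection of \<open>b\<close> onto \<open>U\<close>. Projections are symmetric, so
  \<open>\<langle>b, \<Pi>\<^sub>U Y\<rangle> = \<langle>p, Y\<rangle>\<close>, and both estimators are linear. Unbiasedness of \<open>\<langle>c, Y\<rangle>\<close>
  says \<open>\<langle>c, \<zeta>\<rangle> = \<langle>b, \<zeta>\<rangle>\<close> on \<open>U\<close>, which means that \<open>d = c - p\<close> lies in
  \<open>U\<^sup>\<bottom>\<close>. Hence \<open>\<langle>p, Y\<rangle>\<close> and \<open>\<langle>c, Y\<rangle>\<close> have the same mean \<open>\<langle>b, \<zeta>\<rangle>\<close>, so their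
  risks are their variances \<open>\<sigma>\<^sup>2\<langle>Qp, p\<rangle>\<close> and \<open>\<sigma>\<^sup>2\<langle>Qc, c\<rangle>\<close>
  (\<open>gaussian_measure_variance\<close>). As \<open>Q\<close> preserves \<open>U\<close> and \<open>U\<^sup>\<bottom>\<close>, the mixed terms in
  \<open>\<langle>Q(p + d), p + d\<rangle>\<close> vanish, so the two risks differ exactly by
  \<open>\<sigma>\<^sup>2\<langle>Qd, d\<rangle> \<ge> 0\<close>. If the risks agree, then \<open>\<langle>d, Y\<rangle>\<close> has variance \<open>0\<close> and equals its
  mean \<open>\<langle>d, \<zeta>\<rangle> = 0\<close> almost surely (\<open>gaussian_measure_degenerate\<close>).

  The point that needs completeness of the space is the existence of \<open>p\<close>
  (\<open>orthogonal_decomposition_exists\<close>).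
\<close>

section \<open>Orthogonal projections in Hilbert spaces\<close>

text \<open>By the parallelogram law at the midpoint of two points of \<open>U\<close>, which again lies in \<open>U\<close>,
  near-minimizers of the distance to \<open>x\<close> must be close to each other.\<close>

lemma near_minimizers_close:
  fixes x :: "'a::real_inner"
  assumes "subspace U" "p \<in> U" "q \<in> U"
    and lower: "\<And>u. u \<in> U \<Longrightarrow> D \<le> (norm (x - u))\<^sup>2"
    and "(norm (x - p))\<^sup>2 \<le> D + e" "(norm (x - q))\<^sup>2 \<le> D + e"
  shows "(dist p q)\<^sup>2 \<le> 4 * e"
proof -
  let ?m = "(1/2) *\<^sub>R (p + q)"
  have "?m \<in> U"
    using assms(1-3) by (intro subspace_scale subspace_add)
  then have "D \<le> (norm (x - ?m))\<^sup>2"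
    by (rule lower)
  moreover have "(dist p q)\<^sup>2 =
      2 * (norm (x - p))\<^sup>2 + 2 * (norm (x - q))\<^sup>2 - 4 * (norm (x - ?m))\<^sup>2"
    unfolding dist_norm power2_norm_eq_inner
    by (simp add: inner_diff_left inner_diff_right inner_add_left inner_add_right
        inner_commute field_simps)
  ultimately show ?thesis
    using assms(5,6) by linarith
qed

text \<open>The sets \<open>S n\<close> of near-minimizers are nested and closed, and their diameters tend to \<open>0\<close>, so
  completeness provides a common point.\<close>

lemma nearest_point_exists:
  fixes U :: "'a::{real_inner, complete_space} set"
  assumes "subspace U" "closed U"
  obtains p where "p \<in> U" "\<And>u. u \<in> U \<Longrightarrow> norm (x - p) \<le> norm (x - u)"
proof -
  define D where "D = (INF u\<in>U. (norm (x - u))\<^sup>2)"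
  define S where "S n = {u \<in> U. (norm (x - u))\<^sup>2 \<le> D + inverse (real (Suc n))}" for n
  have bdd: "bdd_below ((\<lambda>u. (norm (x - u))\<^sup>2) ` U)"
    by (rule bdd_belowI[of _ 0]) auto
  have lower: "D \<le> (norm (x - u))\<^sup>2" if "u \<in> U" for u
    unfolding D_def using bdd that by (rule cINF_lower)
  have "closed (S n)" for n
  proof -
    have "S n = U \<inter> {u. (norm (x - u))\<^sup>2 \<le> D + inverse (real (Suc n))}"
      by (auto simp: S_def)
    then show ?thesis
      using assms(2) by (simp add: closed_Int closed_Collect_le continuous_intros)
  qed
  moreover have "S n \<noteq> {}" for n
  proof -
    have "U \<noteq> {}"
      using subspace_0[OF assms(1)] by auto
    moreover have "(INF u\<in>U. (norm (x - u))\<^sup>2) < D + inverse (real (Suc n))"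
      by (simp add: D_def)
    ultimately obtain u where "u \<in> U" "(norm (x - u))\<^sup>2 < D + inverse (real (Suc n))"
      using cINF_less_iff[OF _ bdd] by blast
    then show ?thesis
      by (auto simp: S_def intro: less_imp_le)
  qed
  moreover have "S n \<subseteq> S m" if "m \<le> n" for m n
  proof -
    have "inverse (real (Suc n)) \<le> inverse (real (Suc m))"
      using that by (simp add: le_imp_inverse_le)
    then show ?thesis
      unfolding S_def by (intro Collect_mono) linarith
  qed
  moreover have "\<exists>n. \<forall>p\<in>S n. \<forall>q\<in>S n. dist p q < \<epsilon>" if "\<epsilon> > 0" for \<epsilon>
  proof -
    have "0 < \<epsilon>\<^sup>2 / 4"
      using that by simp
    then obtain n where n: "inverse (real (Suc n)) < \<epsilon>\<^sup>2 / 4"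
      using reals_Archimedean by blast
    have "dist p q < \<epsilon>" if "p \<in> S n" "q \<in> S n" for p q
    proof (rule power2_less_imp_less)
      have "(dist p q)\<^sup>2 \<le> 4 * inverse (real (Suc n))"
        using that by (intro near_minimizers_close[OF assms(1) _ _ lower]) (auto simp: S_def)
      also have "\<dots> < \<epsilon>\<^sup>2"
        using n by linarith
      finally show "(dist p q)\<^sup>2 < \<epsilon>\<^sup>2" .
    qed (use \<open>\<epsilon> > 0\<close> in simp)
    then show ?thesis
      by blast
  qed
  ultimately have "\<exists>p. \<forall>n. p \<in> S n"
    by (rule decreasing_closed_nest[of S]) auto
  then obtain p where p: "\<And>n. p \<in> S n"
    by blast
  have "(norm (x - p))\<^sup>2 \<le> D"
  proof (rule field_le_epsilon)
    fix e :: real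
    assume "e > 0"
    then obtain n where "inverse (real (Suc n)) < e"
      using reals_Archimedean by blast
    then show "(norm (x - p))\<^sup>2 \<le> D + e"
      using p[of n] by (auto simp: S_def)
  qed
  from power2_le_imp_le[OF order_trans[OF this lower] norm_ge_zero]
  have "norm (x - p) \<le> norm (x - u)" if "u \<in> U" for u
    using that .
  moreover have "p \<in> U"
    using p[of 0] by (simp add: S_def)
  ultimately show ?thesis
    using that by blast
qed

text \<open>At a nearest point, moving by \<open>tu\<close> changes the squared distance by
  \<open>t\<^sup>2\<parallel>u\<parallel>\<^sup>2 - 2t\<langle>x - p, u\<rangle>\<close>, which stays nonnegative for small \<open>t\<close> of either sign only if
  the linear coefficient vanishes.\<close>

lemma nearest_point_orthogonal:
  fixes x :: "'a::real_inner"
  assumes "subspace U" "p \<in> U" "\<And>u. u \<in> U \<Longrightarrow> norm (x - p) \<le> norm (x - u)"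
  shows "x - p \<in> U\<^sup>\<bottom>"
proof -
  have "inner u (x - p) = 0" if "u \<in> U" for u
  proof -
    define a where "a = inner u (x - p)"
    define N where "N = (norm u)\<^sup>2"
    define t where "t = a / (N + 1)"
    have "N \<ge> 0"
      by (simp add: N_def)
    have "p + t *\<^sub>R u \<in> U"
      using assms(1,2) that by (intro subspace_add subspace_scale)
    then have "(norm (x - p))\<^sup>2 \<le> (norm (x - (p + t *\<^sub>R u)))\<^sup>2"
      by (intro power_mono assms(3)) auto
    also have "\<dots> = (norm (x - p))\<^sup>2 - 2 * t * a + t\<^sup>2 * N"
      unfolding a_def N_def power2_norm_eq_inner
      by (simp add: inner_diff_left inner_diff_right inner_add_left inner_add_right
          inner_commute power2_eq_square algebra_simps)
    finally have "2 * t * a \<le> t\<^sup>2 * N"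
      by simp
    moreover have "a = t * (N + 1)"
      using \<open>N \<ge> 0\<close> by (simp add: t_def)
    ultimately have "t\<^sup>2 * (N + 2) \<le> 0"
      by (simp add: power2_eq_square algebra_simps)
    then have "t = 0"
      using \<open>N \<ge> 0\<close> by (auto simp: mult_le_0_iff)
    then show ?thesis
      using \<open>a = t * (N + 1)\<close> by (simp add: a_def)
  qed
  then show ?thesis
    by (simp add: orthogonal_comp_def orthogonal_def)
qed

lemma orthogonal_decomposition_exists:
  fixes U :: "'a::{real_inner, complete_space} set"
  assumes "subspace U" "closed U"
  shows "\<exists>p. p \<in> U \<and> x - p \<in> U\<^sup>\<bottom>"
proof -
  obtain p where "p \<in> U" "\<And>u. u \<in> U \<Longrightarrow> norm (x - p) \<le> norm (x - u)"
    using nearest_point_exists[OF assms] by blast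
  then show ?thesis
    using nearest_point_orthogonal[OF assms(1)] by blast
qed

lemma inner_orthogonal_comp:
  assumes "u \<in> U" "w \<in> U\<^sup>\<bottom>"
  shows "inner u w = 0" and "inner w u = 0"
proof -
  show "inner u w = 0"
    using assms by (simp add: orthogonal_comp_def orthogonal_def)
  then show "inner w u = 0"
    by (simp add: inner_commute)
qed

lemma orth_proj_props:
  fixes U :: "'a::{real_inner, complete_space} set"
  assumes "subspace U" "closed U"
  shows "orth_proj U x \<in> U" and "x - orth_proj U x \<in> U\<^sup>\<bottom>"
proof -
  have "p = q" if "p \<in> U \<and> x - p \<in> U\<^sup>\<bottom>" "q \<in> U \<and> x - q \<in> U\<^sup>\<bottom>" for p q
  proof -
    have "p - q \<in> U"
      using that assms(1) by (simp add: subspace_diff)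
    moreover have "p - q \<in> U\<^sup>\<bottom>"
      using subspace_diff[OF subspace_orthogonal_comp, of "x - q" U "x - p"] that by simp
    ultimately have "inner (p - q) (p - q) = 0"
      by (rule inner_orthogonal_comp)
    then show ?thesis
      by simp
  qed
  with orthogonal_decomposition_exists[OF assms]
  have "\<exists>!p. p \<in> U \<and> x - p \<in> U\<^sup>\<bottom>"
    by (rule ex_ex1I)
  then have "orth_proj U x \<in> U \<and> x - orth_proj U x \<in> U\<^sup>\<bottom>"
    unfolding orth_proj_def by (rule theI')
  then show "orth_proj U x \<in> U" "x - orth_proj U x \<in> U\<^sup>\<bottom>"
    by simp_all
qed

lemma inner_orth_proj_commute:
  fixes U :: "'a::{real_inner, complete_space} set"
  assumes "subspace U" "closed U"
  shows "inner x (orth_proj U y) = inner (orth_proj U x) y"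
proof -
  have "inner (x - orth_proj U x) (orth_proj U y) = 0"
    "inner (orth_proj U x) (y - orth_proj U y) = 0"
    using orth_proj_props[OF assms] by (blast intro: inner_orthogonal_comp)+
  then show ?thesis
    by (simp add: inner_diff_left inner_diff_right)
qed

text \<open>Pythagoras' theorem for the form \<open>\<langle>Qx, x\<rangle>\<close>: invariance of both subspaces removes both
  mixed terms.\<close>

lemma quadratic_form_orthogonal_add:
  fixes Q :: "'a::real_inner \<Rightarrow>\<^sub>L 'a"
  assumes "invariant_subspace Q U" "invariant_subspace Q (U\<^sup>\<bottom>)" "u \<in> U" "w \<in> U\<^sup>\<bottom>"
  shows "inner (Q (u + w)) (u + w) = inner (Q u) u + inner (Q w) w"
proof -
  have "Q u \<in> U" "Q w \<in> U\<^sup>\<bottom>"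
    using assms by (auto simp: invariant_subspace_def)
  then have "inner (Q u) w = 0" "inner (Q w) u = 0"
    using assms(3,4) by (auto intro: inner_orthogonal_comp)
  then show ?thesis
    by (simp add: blinfun.add_right inner_add_left inner_add_right)
qed

section \<open>Moments of linear functionals under a Gaussian measure\<close>

lemma integral_normal_law:
  assumes "v \<ge> 0"
  shows "(\<integral>x. x \<partial>normal_law m v) = m"
proof (cases "v = 0")
  case True
  then show ?thesis
    by (simp add: normal_law_def integral_return)
next
  case False
  with assms have "sqrt v > 0"
    by simp
  then show ?thesis
    using False by (simp add: normal_law_def integral_real_density integral_normal_moment_nz_1)
qed

lemma nn_integral_normal_law_square:
  assumes "v \<ge> 0"
  shows "(\<integral>\<^sup>+x. ennreal ((x - m)\<^sup>2) \<partial>normal_law m v) = ennreal v"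
proof (cases "v = 0")
  case True
  then show ?thesis
    by (simp add: normal_law_def nn_integral_return)
next
  case False
  with assms have s: "sqrt v > 0"
    by simp
  have "(\<integral>\<^sup>+x. ennreal ((x - m)\<^sup>2) \<partial>normal_law m v) =
      (\<integral>\<^sup>+x. ennreal (normal_density m (sqrt v) x * (x - m)\<^sup>2) \<partial>lborel)"
    using False by (simp add: normal_law_def nn_integral_density ennreal_mult)
  also have "\<dots> = ennreal (\<integral>x. normal_density m (sqrt v) x * (x - m)\<^sup>2 \<partial>lborel)"
    using integrable_normal_moment[OF s, of m 2] by (intro nn_integral_eq_integral) auto
  also have "(\<integral>x. normal_density m (sqrt v) x * (x - m)\<^sup>2 \<partial>lborel) = v"
    using integral_normal_moment_even[OF s, of m 1] assms by simp
  finally show ?thesis .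
qed

context
  fixes M :: "'a::real_inner measure" and m :: 'a and C :: "'a \<Rightarrow>\<^sub>L 'a"
  assumes gauss: "gaussian_measure M m C"
begin

lemma measurable_inner_gaussian: "(\<lambda>y. inner a y) \<in> borel_measurable M"
proof -
  have "(\<lambda>y::'a. inner a y) \<in> borel_measurable borel"
    by (intro borel_measurable_continuous_onI continuous_intros)
  then show ?thesis
    using gauss measurable_cong_sets[of M borel borel borel]
    unfolding gaussian_measure_def by blast
qed

lemma distr_inner_gaussian:
  "distr M borel (\<lambda>y. inner a y) = normal_law (inner a m) (inner (C a) a)"
  using gauss by (simp add: gaussian_measure_def)

lemma gaussian_measure_mean:
  assumes "inner (C a) a \<ge> 0"
  shows "(\<integral>y. inner a y \<partial>M) = inner a m"
proof -
  have "(\<integral>y. inner a y \<partial>M) = (\<integral>x. x \<partial>distr M borel (\<lambda>y. inner a y))"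
    by (simp add: integral_distr measurable_inner_gaussian)
  then show ?thesis
    using integral_normal_law[OF assms] by (simp add: distr_inner_gaussian)
qed

lemma gaussian_measure_variance:
  assumes "inner (C a) a \<ge> 0"
  shows "(\<integral>\<^sup>+y. ennreal ((inner a y - inner a m)\<^sup>2) \<partial>M) = ennreal (inner (C a) a)"
proof -
  have "(\<integral>\<^sup>+y. ennreal ((inner a y - inner a m)\<^sup>2) \<partial>M) =
      (\<integral>\<^sup>+x. ennreal ((x - inner a m)\<^sup>2) \<partial>distr M borel (\<lambda>y. inner a y))"
    by (simp add: nn_integral_distr measurable_inner_gaussian)
  then show ?thesis
    using nn_integral_normal_law_square[OF assms] by (simp add: distr_inner_gaussian)
qed

lemma gaussian_measure_degenerate:
  assumes "inner (C a) a = 0"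
  shows "AE y in M. inner a y = inner a m"
proof -
  have "AE x in distr M borel (\<lambda>y. inner a y). x = inner a m"
    unfolding distr_inner_gaussian normal_law_def by (simp add: assms AE_return)
  then show ?thesis
    by (subst (asm) AE_distr_iff) (auto simp: measurable_inner_gaussian)
qed

end

section \<open>Optimality of the projection estimator\<close>

theorem theorem5p2:
  fixes U :: "'a::{real_inner, complete_space, second_countable_topology} set"
    and Q :: "'a \<Rightarrow>\<^sub>L 'a"
    and P :: "'a \<times> real \<Rightarrow> 'a measure"
    and b c :: 'a
  assumes "subspace U" and "closed U"
    and "nonneg_operator Q" and "self_adjoint Q" and "nuclear Q"
    and "invariant_subspace Q U" and "invariant_subspace Q (U\<^sup>\<bottom>)"
    and "gaussian_model P U Q"
    and "unbiased_estimator P U b (\<lambda>y. inner c y)"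
  shows "(\<forall>\<theta> \<in> param_space U.
            risk P b \<theta> (\<lambda>y. inner b (orth_proj U y)) \<le> risk P b \<theta> (\<lambda>y. inner c y)) \<and>
         ((\<forall>\<theta> \<in> param_space U.
            risk P b \<theta> (\<lambda>y. inner b (orth_proj U y)) = risk P b \<theta> (\<lambda>y. inner c y)) \<longrightarrow>
          (\<forall>\<theta> \<in> param_space U.
            AE y in P \<theta>. inner c y = inner b (orth_proj U y)))"
proof -
  define p where "p = orth_proj U b"
  define d where "d = c - p"
  have proj: "inner b (orth_proj U y) = inner p y" for y
    unfolding p_def by (rule inner_orth_proj_commute[OF assms(1,2)])
  have p: "p \<in> U" "b - p \<in> U\<^sup>\<bottom>"
    unfolding p_def by (rule orth_proj_props[OF assms(1,2)])+
  have Q: "inner (Q a) a \<ge> 0" for a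
    using assms(3) by (simp add: nonneg_operator_def)
  have gauss: "gaussian_measure (P (\<zeta>, \<sigma>)) \<zeta> (\<sigma>\<^sup>2 *\<^sub>R Q)" if "\<zeta> \<in> U" "\<sigma> > 0" for \<zeta> \<sigma>
    using assms(8) that by (auto simp: gaussian_model_def param_space_def)
  have cov: "inner ((\<sigma>\<^sup>2 *\<^sub>R Q) a) a = \<sigma>\<^sup>2 * inner (Q a) a" for \<sigma> a
    by (simp add: scaleR_blinfun.rep_eq)
  have inner_p: "inner p \<zeta> = inner b \<zeta>" if "\<zeta> \<in> U" for \<zeta>
    using inner_orthogonal_comp(2)[OF that p(2)] by (simp add: inner_diff_left)
  have inner_c: "inner c \<zeta> = inner b \<zeta>" if "\<zeta> \<in> U" for \<zeta>
  proof -
    have "(\<integral>y. inner c y \<partial>P (\<zeta>, 1)) = inner b \<zeta>"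
      using assms(9) that by (auto simp: unbiased_estimator_def param_space_def)
    moreover have "(\<integral>y. inner c y \<partial>P (\<zeta>, 1)) = inner c \<zeta>"
      using gaussian_measure_mean[OF gauss[OF that, of 1]] Q by (simp add: cov)
    ultimately show ?thesis
      by simp
  qed
  have inner_d: "inner d \<zeta> = 0" if "\<zeta> \<in> U" for \<zeta>
    using inner_c[OF that] inner_p[OF that] by (simp add: d_def inner_diff_left)
  then have "d \<in> U\<^sup>\<bottom>"
    by (simp add: orthogonal_comp_def orthogonal_def inner_commute)
  then have "inner (Q (p + d)) (p + d) = inner (Q p) p + inner (Q d) d"
    by (rule quadratic_form_orthogonal_add[OF assms(6,7) p(1)])
  then have pythagoras: "inner (Q c) c = inner (Q p) p + inner (Q d) d"
    by (simp add: d_def)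
  have risk: "risk P b (\<zeta>, \<sigma>) (\<lambda>y. inner a y) = ennreal (\<sigma>\<^sup>2 * inner (Q a) a)"
    if "\<zeta> \<in> U" "\<sigma> > 0" "inner a \<zeta> = inner b \<zeta>" for \<zeta> \<sigma> a
    using gaussian_measure_variance[OF gauss[OF that(1,2)], of a] that(3) Q
    by (simp add: risk_def cov)
  show ?thesis
    unfolding proj
  proof (intro conjI impI ballI)
    fix \<theta>
    assume "\<theta> \<in> param_space U"
    then obtain \<zeta> \<sigma> where \<theta>: "\<theta> = (\<zeta>, \<sigma>)" "\<zeta> \<in> U" "\<sigma> > 0"
      by (auto simp: param_space_def)
    have "\<sigma>\<^sup>2 * inner (Q p) p \<le> \<sigma>\<^sup>2 * inner (Q c) c"
      using Q[of d] by (simp add: pythagoras mult_left_mono)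
    then show "risk P b \<theta> (\<lambda>y. inner p y) \<le> risk P b \<theta> (\<lambda>y. inner c y)"
      using \<theta> by (simp add: risk inner_p inner_c ennreal_leI)
  next
    fix \<theta>
    assume eq: "\<forall>\<theta>\<in>param_space U. risk P b \<theta> (\<lambda>y. inner p y) = risk P b \<theta> (\<lambda>y. inner c y)"
      and mem: "\<theta> \<in> param_space U"
    then obtain \<zeta> \<sigma> where \<theta>: "\<theta> = (\<zeta>, \<sigma>)" "\<zeta> \<in> U" "\<sigma> > 0"
      by (auto simp: param_space_def)
    have "ennreal (\<sigma>\<^sup>2 * inner (Q p) p) = ennreal (\<sigma>\<^sup>2 * inner (Q c) c)"
      using eq mem \<theta> by (auto simp: risk inner_p inner_c)
    then have "inner (Q d) d = 0"
      using \<open>\<sigma> > 0\<close> Q by (simp add: pythagoras)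
    then have "AE y in P (\<zeta>, \<sigma>). inner d y = inner d \<zeta>"
      by (intro gaussian_measure_degenerate[OF gauss[OF \<theta>(2,3)]]) (simp add: cov)
    then show "AE y in P \<theta>. inner c y = inner p y"
      using inner_d[OF \<theta>(2)] unfolding \<theta>(1) by (simp add: d_def inner_diff_left)
  qed
qed

end
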